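(* Let $R$ be an elliptic root system with marking, let $\widetilde c\in W$ be a hyperbolic Coxeter transformation, and let $\widetilde c^{ss}$ be its semi-simple part. Put $$\widetilde X:=\{V\subset\widetilde F \text{ real subspace}\mid \widetilde F=V\oplus\mathrm{rad}\,I\},\quad \widetilde X^{reg}:=\{V\in\widetilde X\mid V\cap R=\emptyset\},\quad \widetilde X^{\widetilde c^{ss}}:=\{V\in\widetilde X\mid \widetilde c^{ss}\cdot V=V\}.$$ Then $$\widetilde X^{\widetilde c^{ss}}\cap\widetilde X^{reg}\neq\emptyset .$$
   Context: Root system. $l\ge 1$ is an integer, $n=l+1$. $F$ is a real vector space of dimension $l+2$ with a positive semi-definite symmetric bilinear form $I$ whose radical $\mathrm{rad}\,I$ has dimension $2$. For $\alpha\in F$ with $I(\alpha,\alpha)\ne0$ put $\alpha^\vee=2\alpha/I(\alpha,\alpha)$, $w_\alpha(u)=u-I(u,\alpha^\vee)\alpha$. $R\subset F$ is an elliptic root system belonging to $(F,I)$: a set of vectors with $I(\alpha,\alpha)\neq 0$ such that (1) the additive group $Q(R)$ generated by $R$ is a full lattice in $F$; (2) $I(\alpha,\beta^\vee)\in\mathbb Z$ for $\alpha,\beta\in R$; (3) $w_\alpha(R)=R$ for $\alpha\in R$; (4) if $R=R_1\cup R_2$ with $R_1\perp R_2$ then $R_1$ or $R_2$ is empty. A marking is fixed: a line $G\subset\mathrm{rad}\,I$ with $G\cap Q(R)\simeq\mathbb Z$; $a,\delta$ are chosen with $G\cap Q(R)=\mathbb Za$, $Q(R)\cap\mathrm{rad}\,I=\mathbb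 Za\oplus\mathbb Z\delta$. $(I_R:I)>0$ is the smallest number such that $(I_R:I)I$ makes $Q(R)$ an even lattice. Hyperbolic extension. $\widetilde F\supset F$ is a real vector space of dimension $l+3$ with symmetric bilinear form $\widetilde I$, $\widetilde I|_F=I$, $\mathrm{rad}\,\widetilde I=\mathbb Ra$. $O(F,\mathrm{rad}\,I)$ is the group of $g\in GL(F)$ preserving $I$ with $g|_{\mathrm{rad}\,I}=id$; $O(\widetilde F,F,\mathrm{rad}\,I)$ is the group of $g\in GL(\widetilde F)$ preserving $\widetilde I$ with $g(F)\subset F$ and $g|_F\in O(F,\mathrm{rad}\,I)$; $K_{\mathbb R}$ is the kernel of the restriction map $O(\widetilde F,F,\mathrm{rad}\,I)\to O(F,\mathrm{rad}\,I)$. The elliptic Weyl group $W\subset O(\widetilde F,F,\mathrm{rad}\,I)$ is generated by $\widetilde w_\alpha(u)=u-\widetilde I(u,\alpha^\vee)\alpha$ ($\alpha\in R$); $K_{\mathbb Z}:=W\cap K_{\mathbb R}\simeq\mathbb Z$. Exponents. Following Saito, the image of $R$ in $F/G$ is a reduced affine root system. Let $\alpha_0,\dots,\alpha_l\in R$ be lifts of its simple roots, $n_i$ the coprime positive integers with $\sum n_i\alpha_i\equiv\pm\delta$ mod $G$, $k(\alpha)=\min\{k\in\mathbb Z_{>0}\mid\alpha+ka\in R\}$. The exponents $m_0\le\dots\le m_l=:m_{max}$ are the numbers $(I_R:I)I(\alpha_i,\alpha_i)n_i/(2k(\alpha_i))$ in increasing order. $d_n$ is the smallest common denominator of the $m_i/m_{max}$,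 and $d_\alpha:=m_{\alpha-1}d_n/m_{max}$ ($1\le\alpha\le n$). Hyperbolic Coxeter transformation. By a theorem of Saito (taken as given) there is $\widetilde c\in W$, called a hyperbolic Coxeter transformation, such that, with $c:=\widetilde c|_F$: (A) $c$ is semi-simple of order $d_n$, with eigenvalues $1$ and $\exp(2\pi\sqrt{-1}\,d_\alpha/d_n)$ ($\alpha=1,\dots,n$); (B) $R\cap\mathrm{Im}(c-id)=\emptyset$; (C) $(\widetilde c-1)\xi+(I_R:I)\widetilde I(\xi,\delta)\frac1{m_{max}}a\in\mathrm{Im}(c-id)$ for all $\xi\in\widetilde F$, and $\widetilde c^{\,d_n}$ generates $K_{\mathbb Z}$. $\widetilde c=\widetilde c^{ss}\cdot\widetilde c^{unip}$ denotes the (multiplicative) Jordan decomposition. *)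

theory Defs
  imports
    Complex_Main
    "HOL-Computational_Algebra.Group_Closure"
    "HOL-Algebra.Bij"
    "HOL-Algebra.Generated_Groups"
    "Jordan_Normal_Form.Char_Poly"
begin

section \<open>Symmetric bilinear forms on a subspace\<close>

text \<open>A real vector space \<open>F\<close> is given as a subspace of an ambient type; only the values
  of a form and of an endomorphism on \<open>F\<close> matter.\<close>

definition sym_bilinear_on :: "'v::real_vector set \<Rightarrow> ('v \<Rightarrow> 'v \<Rightarrow> real) \<Rightarrow> bool" where
  "sym_bilinear_on F I \<longleftrightarrow>
     (\<forall>x\<in>F. \<forall>y\<in>F. I x y = I y x) \<and>
     (\<forall>x\<in>F. \<forall>y\<in>F. \<forall>z\<in>F. I (x + y) z = I x z + I y z) \<and>
     (\<forall>r. \<forall>x\<in>F. \<forall>y\<in>F. I (r *\<^sub>R x) y = r * I x y)"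

definition radical :: "'v set \<Rightarrow> ('v \<Rightarrow> 'v \<Rightarrow> real) \<Rightarrow> 'v set" where
  "radical F I = {x \<in> F. \<forall>y\<in>F. I x y = 0}"

definition direct_sum :: "'v::real_vector set \<Rightarrow> 'v set \<Rightarrow> 'v set \<Rightarrow> bool" where
  "direct_sum F U V \<longleftrightarrow>
     subspace U \<and> subspace V \<and> U \<inter> V = {0} \<and> F = {u + v |u v. u \<in> U \<and> v \<in> V}"

section \<open>Elliptic root systems with marking\<close>

definition coroot :: "('v::real_vector \<Rightarrow> 'v \<Rightarrow> real) \<Rightarrow> 'v \<Rightarrow> 'v" where
  "coroot I \<alpha> = (2 / I \<alpha> \<alpha>) *\<^sub>R \<alpha>"

definition reflection :: "('v::real_vector \<Rightarrow> 'v \<Rightarrow> real) \<Rightarrow> 'v \<Rightarrow> 'v \<Rightarrow> 'v" where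
  "reflection I \<alpha> u = u - I u (coroot I \<alpha>) *\<^sub>R \<alpha>"

abbreviation root_lattice :: "'v::real_vector set \<Rightarrow> 'v set" where
  "root_lattice R \<equiv> group_closure R"

definition full_lattice :: "'v::real_vector set \<Rightarrow> 'v set \<Rightarrow> bool" where
  "full_lattice F Q \<longleftrightarrow>
     (\<exists>B. finite B \<and> independent B \<and> span B = F \<and>
          Q = {\<Sum>b\<in>B. of_int (z b) *\<^sub>R b |z::'v \<Rightarrow> int. True})"

definition elliptic_root_system ::
    "nat \<Rightarrow> 'v::real_vector set \<Rightarrow> ('v \<Rightarrow> 'v \<Rightarrow> real) \<Rightarrow> 'v set \<Rightarrow> bool" where
  "elliptic_root_system l F I R \<longleftrightarrow>
     subspace F \<and> dim F = l + 2 \<and>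
     sym_bilinear_on F I \<and> (\<forall>x\<in>F. I x x \<ge> 0) \<and> dim (radical F I) = 2 \<and>
     R \<subseteq> F \<and> (\<forall>\<alpha>\<in>R. I \<alpha> \<alpha> \<noteq> 0) \<and>
     full_lattice F (root_lattice R) \<and>
     (\<forall>\<alpha>\<in>R. \<forall>\<beta>\<in>R. I \<alpha> (coroot I \<beta>) \<in> \<int>) \<and>
     (\<forall>\<alpha>\<in>R. reflection I \<alpha> ` R = R) \<and>
     (\<forall>R1 R2. R = R1 \<union> R2 \<and> (\<forall>\<alpha>\<in>R1. \<forall>\<beta>\<in>R2. I \<alpha> \<beta> = 0) \<longrightarrow> R1 = {} \<or> R2 = {})"

text \<open>The last conjunct says that the sum \<open>\<int>a + \<int>\<delta>\<close> is direct with \<open>a\<close>, \<open>\<delta>\<close> non-zero; in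
  particular \<open>G \<inter> Q(R) = \<int>a\<close> is infinite cyclic.\<close>

definition marking ::
    "'v::real_vector set \<Rightarrow> ('v \<Rightarrow> 'v \<Rightarrow> real) \<Rightarrow> 'v set \<Rightarrow> 'v set \<Rightarrow> 'v \<Rightarrow> 'v \<Rightarrow> bool" where
  "marking F I R G a \<delta> \<longleftrightarrow>
     subspace G \<and> dim G = 1 \<and> G \<subseteq> radical F I \<and>
     G \<inter> root_lattice R = {of_int i *\<^sub>R a |i::int. True} \<and>
     root_lattice R \<inter> radical F I = {of_int i *\<^sub>R a + of_int j *\<^sub>R \<delta> |(i::int) (j::int). True} \<and>
     (\<forall>(i::int) (j::int). of_int i *\<^sub>R a + of_int j *\<^sub>R \<delta> = 0 \<longrightarrow> i = 0 \<and> j = 0)"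

text \<open>Integrality of the form follows from evenness of the norms by polarization.\<close>

definition even_lattice :: "'v set \<Rightarrow> ('v \<Rightarrow> 'v \<Rightarrow> real) \<Rightarrow> bool" where
  "even_lattice Q J \<longleftrightarrow> (\<forall>x\<in>Q. \<exists>k::int. J x x = 2 * of_int k)"

text \<open>\<open>is_even_scale I R r\<close>: \<open>r\<close> is the number \<open>(I\<^sub>R : I)\<close>.\<close>

definition is_even_scale :: "('v::real_vector \<Rightarrow> 'v \<Rightarrow> real) \<Rightarrow> 'v set \<Rightarrow> real \<Rightarrow> bool" where
  "is_even_scale I R r \<longleftrightarrow>
     r > 0 \<and> even_lattice (root_lattice R) (\<lambda>x y. r * I x y) \<and>
     (\<forall>r'>0. even_lattice (root_lattice R) (\<lambda>x y. r' * I x y) \<longrightarrow> r \<le> r')"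

section \<open>Exponents\<close>

text \<open>Vectors of the quotient \<open>F/G\<close> are represented by lifts to \<open>F\<close>, equality in the quotient
  being congruence modulo \<open>G\<close>. The image of \<open>R\<close> in \<open>F/G\<close> is reduced if two proportional
  elements of it are equal or opposite.\<close>

definition reduced_mod :: "'v::real_vector set \<Rightarrow> 'v set \<Rightarrow> bool" where
  "reduced_mod G R \<longleftrightarrow>
     (\<forall>\<alpha>\<in>R. \<forall>\<beta>\<in>R. \<forall>t::real. \<beta> - t *\<^sub>R \<alpha> \<in> G \<longrightarrow> t = 1 \<or> t = - 1)"

text \<open>\<open>\<alpha> 0, \<dots>, \<alpha> l\<close> lift the simple roots (a base) of the image of \<open>R\<close> in \<open>F/G\<close>: they are
  linearly independent modulo \<open>G\<close>, and modulo \<open>G\<close> every root is an integral combination of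
  them with all coefficients non-negative or all non-positive.\<close>

definition simple_roots_mod ::
    "nat \<Rightarrow> 'v::real_vector set \<Rightarrow> 'v set \<Rightarrow> (nat \<Rightarrow> 'v) \<Rightarrow> bool" where
  "simple_roots_mod l G R \<alpha> \<longleftrightarrow>
     (\<forall>i\<le>l. \<alpha> i \<in> R) \<and>
     (\<forall>r::nat \<Rightarrow> real. (\<Sum>i\<le>l. r i *\<^sub>R \<alpha> i) \<in> G \<longrightarrow> (\<forall>i\<le>l. r i = 0)) \<and>
     (\<forall>\<beta>\<in>R. \<exists>p::nat \<Rightarrow> nat. \<beta> - (\<Sum>i\<le>l. of_nat (p i) *\<^sub>R \<alpha> i) \<in> G \<or>
                             \<beta> + (\<Sum>i\<le>l. of_nat (p i) *\<^sub>R \<alpha> i) \<in> G)"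

definition null_root_coeffs ::
    "nat \<Rightarrow> 'v::real_vector set \<Rightarrow> 'v \<Rightarrow> (nat \<Rightarrow> 'v) \<Rightarrow> (nat \<Rightarrow> nat) \<Rightarrow> bool" where
  "null_root_coeffs l G \<delta> \<alpha> n \<longleftrightarrow>
     (\<forall>i\<le>l. n i > 0) \<and> Gcd (n ` {..l}) = 1 \<and>
     ((\<Sum>i\<le>l. of_nat (n i) *\<^sub>R \<alpha> i) - \<delta> \<in> G \<or> (\<Sum>i\<le>l. of_nat (n i) *\<^sub>R \<alpha> i) + \<delta> \<in> G)"

definition period :: "'v::real_vector set \<Rightarrow> 'v \<Rightarrow> 'v \<Rightarrow> nat" where
  "period R a \<alpha> = (LEAST k. k > 0 \<and> \<alpha> + of_nat k *\<^sub>R a \<in> R)"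

text \<open>The list \<open>[m\<^sub>0, \<dots>, m\<^sub>l]\<close>; the parameter \<open>r\<close> is \<open>(I\<^sub>R : I)\<close>.\<close>

definition exponents ::
    "nat \<Rightarrow> ('v::real_vector \<Rightarrow> 'v \<Rightarrow> real) \<Rightarrow> real \<Rightarrow> 'v set \<Rightarrow> 'v \<Rightarrow> (nat \<Rightarrow> 'v) \<Rightarrow> (nat \<Rightarrow> nat)
      \<Rightarrow> real list" where
  "exponents l I r R a \<alpha> n =
     sort (map (\<lambda>i. r * I (\<alpha> i) (\<alpha> i) * real (n i) / (2 * real (period R a (\<alpha> i)))) [0..<l + 1])"

definition max_exponent :: "real list \<Rightarrow> real" where
  "max_exponent ms = last ms"

definition common_denom :: "real list \<Rightarrow> nat" where
  "common_denom ms = (LEAST d. d > 0 \<and> (\<forall>m\<in>set ms. real d * (m / max_exponent ms) \<in> \<int>))"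

definition degree_weight :: "real list \<Rightarrow> nat \<Rightarrow> real" where
  "degree_weight ms j = ms ! (j - 1) * real (common_denom ms) / max_exponent ms"

section \<open>Hyperbolic extension and elliptic Weyl group\<close>

text \<open>The extended space is the whole ambient type, \<open>It\<close> is its form.\<close>

definition hyperbolic_extension ::
    "nat \<Rightarrow> 'v::real_vector set \<Rightarrow> ('v \<Rightarrow> 'v \<Rightarrow> real) \<Rightarrow> ('v \<Rightarrow> 'v \<Rightarrow> real) \<Rightarrow> 'v \<Rightarrow> bool" where
  "hyperbolic_extension l F I It a \<longleftrightarrow>
     dim (UNIV :: 'v set) = l + 3 \<and> sym_bilinear_on UNIV It \<and>
     (\<forall>x\<in>F. \<forall>y\<in>F. It x y = I x y) \<and> radical UNIV It = {r *\<^sub>R a |r. True}"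

definition orthogonal_grp ::
    "'v::real_vector set \<Rightarrow> ('v \<Rightarrow> 'v \<Rightarrow> real) \<Rightarrow> ('v \<Rightarrow> 'v \<Rightarrow> real) \<Rightarrow> ('v \<Rightarrow> 'v) set" where
  "orthogonal_grp F I It =
     {g. linear g \<and> bij g \<and> (\<forall>x y. It (g x) (g y) = It x y) \<and> g ` F \<subseteq> F \<and>
         (\<forall>x\<in>F. \<forall>y\<in>F. I (g x) (g y) = I x y) \<and> (\<forall>x\<in>radical F I. g x = x)}"

definition restriction_kernel ::
    "'v::real_vector set \<Rightarrow> ('v \<Rightarrow> 'v \<Rightarrow> real) \<Rightarrow> ('v \<Rightarrow> 'v \<Rightarrow> real) \<Rightarrow> ('v \<Rightarrow> 'v) set" where
  "restriction_kernel F I It = {g \<in> orthogonal_grp F I It. \<forall>x\<in>F. g x = x}"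

text \<open>The coroot is formed with \<open>It\<close>, which agrees with \<open>I\<close> on roots.\<close>

definition elliptic_weyl_group :: "('v::real_vector \<Rightarrow> 'v \<Rightarrow> real) \<Rightarrow> 'v set \<Rightarrow> ('v \<Rightarrow> 'v) set" where
  "elliptic_weyl_group It R = generate (BijGroup UNIV) (reflection It ` R)"

section \<open>Semi-simple endomorphisms, Jordan decomposition, eigenvalues\<close>

text \<open>Every invariant subspace has an invariant complement; over the reals this amounts to
  diagonalizability over the complex numbers.\<close>

definition semisimple_on :: "'v::real_vector set \<Rightarrow> ('v \<Rightarrow> 'v) \<Rightarrow> bool" where
  "semisimple_on F f \<longleftrightarrow>
     (\<forall>U. subspace U \<and> U \<subseteq> F \<and> f ` U \<subseteq> U \<longrightarrow> (\<exists>V. direct_sum F U V \<and> f ` V \<subseteq> V))"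

definition unipotent :: "('v::real_vector \<Rightarrow> 'v) \<Rightarrow> bool" where
  "unipotent f \<longleftrightarrow> (\<exists>N. \<forall>x. ((\<lambda>y. f y - y) ^^ N) x = 0)"

definition mult_jordan_decomposition ::
    "('v::real_vector \<Rightarrow> 'v) \<Rightarrow> ('v \<Rightarrow> 'v) \<Rightarrow> ('v \<Rightarrow> 'v) \<Rightarrow> bool" where
  "mult_jordan_decomposition g s u \<longleftrightarrow>
     linear s \<and> linear u \<and> g = s \<circ> u \<and> s \<circ> u = u \<circ> s \<and> semisimple_on UNIV s \<and> unipotent u"

definition has_order_on :: "'v set \<Rightarrow> ('v \<Rightarrow> 'v) \<Rightarrow> nat \<Rightarrow> bool" where
  "has_order_on F f d \<longleftrightarrow>
     d > 0 \<and> (\<forall>x\<in>F. (f ^^ d) x = x) \<and> (\<forall>k. 0 < k \<and> k < d \<longrightarrow> (\<exists>x\<in>F. (f ^^ k) x \<noteq> x))"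

definition matrix_on :: "'v::real_vector list \<Rightarrow> ('v \<Rightarrow> 'v) \<Rightarrow> real mat" where
  "matrix_on bs f =
     mat (length bs) (length bs) (\<lambda>(i, j). representation (set bs) (f (bs ! j)) (bs ! i))"

text \<open>\<open>M\<close> is the multiset of complex eigenvalues of \<open>f\<close> on \<open>F\<close>, counted with algebraic
  multiplicity. The characteristic polynomial does not depend on the basis.\<close>

definition has_eigenvalues_on ::
    "'v::real_vector set \<Rightarrow> ('v \<Rightarrow> 'v) \<Rightarrow> complex multiset \<Rightarrow> bool" where
  "has_eigenvalues_on F f M \<longleftrightarrow>
     (\<exists>bs. distinct bs \<and> independent (set bs) \<and> span (set bs) = F \<and>
           char_poly (map_mat complex_of_real (matrix_on bs f)) = (\<Prod>z\<in>#M. [:- z, 1:]))"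

section \<open>Hyperbolic Coxeter transformations\<close>

text \<open>\<open>(\<lambda>x. c x - x) ` F\<close> is the image of \<open>c|\<^sub>F - id\<close>; \<open>r\<close> is \<open>(I\<^sub>R : I)\<close> and
  \<open>ms\<close> is the list of exponents, of length \<open>l + 1\<close>.\<close>

definition hyperbolic_coxeter ::
    "'v::real_vector set \<Rightarrow> ('v \<Rightarrow> 'v \<Rightarrow> real) \<Rightarrow> ('v \<Rightarrow> 'v \<Rightarrow> real) \<Rightarrow> 'v set \<Rightarrow> 'v \<Rightarrow> 'v
      \<Rightarrow> real \<Rightarrow> real list \<Rightarrow> ('v \<Rightarrow> 'v) \<Rightarrow> bool" where
  "hyperbolic_coxeter F I It R a \<delta> r ms c \<longleftrightarrow>
     c \<in> elliptic_weyl_group It R \<and>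
     semisimple_on F c \<and> has_order_on F c (common_denom ms) \<and>
     has_eigenvalues_on F c
       (add_mset 1 (image_mset
          (\<lambda>j. exp (2 * of_real pi * \<i> * of_real (degree_weight ms j / real (common_denom ms))))
          (mset_set {1..length ms}))) \<and>
     R \<inter> (\<lambda>x. c x - x) ` F = {} \<and>
     (\<forall>\<xi>. (c \<xi> - \<xi>) + (r * It \<xi> \<delta> / max_exponent ms) *\<^sub>R a \<in> (\<lambda>x. c x - x) ` F) \<and>
     generate (BijGroup UNIV) {c ^^ common_denom ms}
       = elliptic_weyl_group It R \<inter> restriction_kernel F I It"

section \<open>Splittings of the radical\<close>

definition splittings :: "'v::real_vector set \<Rightarrow> ('v \<Rightarrow> 'v \<Rightarrow> real) \<Rightarrow> 'v set set" where
  "splittings F I = {V. direct_sum UNIV V (radical F I)}"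

definition regular_splittings ::
    "'v::real_vector set \<Rightarrow> ('v \<Rightarrow> 'v \<Rightarrow> real) \<Rightarrow> 'v set \<Rightarrow> 'v set set" where
  "regular_splittings F I R = {V \<in> splittings F I. V \<inter> R = {}}"

definition fixed_splittings ::
    "'v::real_vector set \<Rightarrow> ('v \<Rightarrow> 'v \<Rightarrow> real) \<Rightarrow> ('v \<Rightarrow> 'v) \<Rightarrow> 'v set set" where
  "fixed_splittings F I s = {V \<in> splittings F I. s ` V = V}"

end

theory Submission
  imports Defs
    "HOL-Analysis.Continuum_Not_Denumerable"
    "HOL-Analysis.Finite_Cartesian_Product"
begin

text \<open>Since \<open>c\<close> has finite order \<open>d\<close> on \<open>F\<close> and acts trivially modulo \<open>F\<close>, its \<open>d\<close>-th power is
  unipotent, so the semi-simple part satisfies \<open>css^d = 1\<close>. It follows that \<open>css\<close> agrees with \<open>c\<close>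
  on \<open>F\<close> and, by semi-simplicity, that the image \<open>M\<close> of \<open>css - 1\<close> is already the image of
  \<open>c|\<^sub>F - 1\<close>. Any subspace containing \<open>M\<close> is therefore stable under \<open>css\<close>. Now \<open>M\<close> meets the radical
  trivially, because \<open>c^m x = x + m (c x - x)\<close> as soon as \<open>c x - x\<close> is fixed, and it contains no
  root. As there are only countably many roots, a generic complement of the radical containing
  \<open>M\<close> contains no root either.\<close>

section \<open>Unipotent and semi-simple maps\<close>

lemma linear_funpow:
  fixes f :: "'v::real_vector \<Rightarrow> 'v"
  assumes "linear f"
  shows "linear (f ^^ n)"
proof (induction n)
  case 0
  then show ?case by (simp add: linear_id[unfolded id_def])
next
  case (Suc n)
  then show ?case using linear_compose[OF Suc assms] by (simp add: o_def)
qed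

text \<open>Modulo \<open>W\<close> the increment \<open>f x - x\<close> is fixed by
  \<open>f\<close>, so each further application of \<open>f\<close> adds it once more.\<close>

lemma funpow_mod_fixed_increment:
  fixes f :: "'v::real_vector \<Rightarrow> 'v"
  assumes f: "linear f" and W: "subspace W" and fW: "f ` W \<subseteq> W"
    and y: "f (f x - x) - (f x - x) \<in> W"
  shows "(f ^^ m) x - x - real m *\<^sub>R (f x - x) \<in> W"
proof (induction m)
  case 0
  then show ?case using W by (simp add: subspace_0)
next
  case (Suc m)
  let ?y = "f x - x" and ?z = "(f ^^ m) x - x - real m *\<^sub>R (f x - x)"
  have "(f ^^ Suc m) x - x - real (Suc m) *\<^sub>R ?y = f ?z + real m *\<^sub>R (f ?y - ?y)"
    by (simp add: linear_diff[OF f] linear_add[OF f] linear_scale[OF f] algebra_simps)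
  moreover have "f ?z \<in> W" using Suc fW by blast
  ultimately show ?case using W y by (simp add: subspace_add subspace_scale)
qed

text \<open>Induction on the nilpotency index: the increment \<open>f x - x\<close> inherits both
  assumptions with a smaller \<open>k\<close>, so it is itself fixed modulo \<open>W\<close>. Then
  \<open>d\<close> times the increment lies in \<open>W\<close>, and division by \<open>d\<close> is
  possible over the reals.\<close>

lemma unipotent_mod_finite_order:
  fixes f :: "'v::real_vector \<Rightarrow> 'v"
  assumes f: "linear f" and W: "subspace W" and fW: "f ` W \<subseteq> W" and d: "d > 0"
    and nil: "((\<lambda>y. f y - y) ^^ k) x \<in> W" and fin: "(f ^^ d) x - x \<in> W"
  shows "f x - x \<in> W"
  using nil fin
proof (induction k arbitrary: x)
  case 0
  then show ?case using W fW by (auto intro: subspace_diff)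
next
  case (Suc k)
  let ?y = "f x - x"
  have nil: "((\<lambda>y. f y - y) ^^ k) ?y \<in> W"
    using Suc.prems(1) by (simp only: funpow_Suc_right o_apply)
  have "(f ^^ d) ?y - ?y = f ((f ^^ d) x - x) - ((f ^^ d) x - x)"
    by (simp add: linear_diff[OF f] linear_diff[OF linear_funpow[OF f]] funpow_swap1)
  moreover have "f ((f ^^ d) x - x) - ((f ^^ d) x - x) \<in> W"
    using Suc.prems(2) W fW by (auto intro: subspace_diff)
  ultimately have "(f ^^ d) ?y - ?y \<in> W" by (simp only:)
  with nil have "f ?y - ?y \<in> W" by (rule Suc.IH)
  then have "(f ^^ d) x - x - real d *\<^sub>R ?y \<in> W"
    by (rule funpow_mod_fixed_increment[OF f W fW])
  then have "real d *\<^sub>R ?y \<in> W"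
    using subspace_diff[OF W Suc.prems(2)] by force
  then have "(1 / real d) *\<^sub>R (real d *\<^sub>R ?y) \<in> W"
    using W by (rule subspace_scale[rotated])
  then show ?case using d by simp
qed

lemma funpow_commute:
  assumes "\<And>x. f (g x) = g (f x)"
  shows "(f ^^ n) (g x) = g ((f ^^ n) x)"
  by (induction n) (simp_all add: assms)

text \<open>Applying the difference once replaces \<open>x\<close> by \<open>P x\<close> and
  \<open>T (N x)\<close>: the first lowers \<open>p\<close>, the second lowers \<open>q\<close>. The
  statement is pointwise in \<open>x\<close> so that the induction can move to these
  vectors.\<close>

lemma nilpotent_diff:
  fixes P N T :: "'v::real_vector \<Rightarrow> 'v"
  assumes "linear P" "linear N" "linear T"
    and PN: "\<And>x. P (N x) = N (P x)" and PT: "\<And>x. P (T x) = T (P x)"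
    and NT: "\<And>x. N (T x) = T (N x)"
    and "(P ^^ p) x = 0" "(N ^^ q) x = 0"
  shows "((\<lambda>y. P y - T (N y)) ^^ (p + q)) x = 0"
  using assms(7,8)
proof (induction "p + q" arbitrary: p q x)
  case 0
  then show ?case by simp
next
  case (Suc k)
  let ?D = "\<lambda>y. P y - T (N y)"
  have "linear ?D"
    using assms(1-3) linear_compose_sub[OF assms(1) linear_compose[OF assms(2,3)]]
    by (simp add: o_def)
  then have lin: "linear (?D ^^ k)" by (rule linear_funpow)
  show ?case
  proof (cases "p = 0 \<or> q = 0")
    case True
    then have "x = 0" using Suc.prems by auto
    then show ?thesis using linear_funpow[OF \<open>linear ?D\<close>] by (simp add: linear_0)
  next
    case False
    then obtain p' q' where pq: "p = Suc p'" "q = Suc q'" by (meson not0_implies_Suc)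
    have "(P ^^ p') (P x) = 0"
      using Suc.prems(1) unfolding pq by (simp only: funpow_Suc_right o_apply)
    moreover have "(N ^^ q) (P x) = P ((N ^^ q) x)"
      by (rule funpow_commute) (simp add: PN)
    ultimately have "(?D ^^ (p' + q)) (P x) = 0"
      using Suc.hyps pq Suc.prems assms(1) by (intro Suc.hyps(1)) (simp_all add: linear_0)
    moreover have "(P ^^ p) (T (N x)) = T (N ((P ^^ p) x))"
      using funpow_commute[of P "\<lambda>x. T (N x)" p x] by (simp add: PN PT)
    moreover have "(N ^^ q') (T (N x)) = T ((N ^^ q) x)"
      using funpow_commute[of N T q' "N x"] unfolding pq
      by (simp only: NT funpow_Suc_right o_apply)
    ultimately have "(?D ^^ (p + q')) (T (N x)) = 0"
      using Suc.hyps pq Suc.prems assms(2,3) by (intro Suc.hyps(1)) (simp_all add: linear_0)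
    moreover have "p' + q = k" "p + q' = k" using Suc.hyps(2) pq by simp_all
    moreover have "(?D ^^ k) (?D x) = (?D ^^ k) (P x) - (?D ^^ k) (T (N x))"
      by (rule linear_diff[OF lin])
    ultimately have "(?D ^^ k) (?D x) = 0"
      using \<open>(?D ^^ (p' + q)) (P x) = 0\<close> by simp
    then show ?thesis
      unfolding Suc.hyps(2)[symmetric] by (simp only: funpow_Suc_right o_apply)
  qed
qed

text \<open>With commuting factors, \<open>f - 1 = (f g - 1) - f (g - 1)\<close> is a difference of
  commuting nilpotent maps. This form avoids inverting \<open>g\<close>.\<close>

lemma unipotent_left_factor:
  fixes f g :: "'v::real_vector \<Rightarrow> 'v"
  assumes f: "linear f" and g: "linear g" and fg: "f \<circ> g = g \<circ> f"
    and "unipotent (f \<circ> g)" "unipotent g"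
  shows "unipotent f"
proof -
  have comm: "f (g x) = g (f x)" for x using fg by (metis o_apply)
  obtain p q where pq: "((\<lambda>y. f (g y) - y) ^^ p) x = 0" "((\<lambda>y. g y - y) ^^ q) x = 0" for x
    using assms(4,5) unfolding unipotent_def by (auto simp: o_def)
  have lin: "linear (\<lambda>y. f (g y) - y)" "linear (\<lambda>y. g y - y)"
    using linear_compose_sub[OF linear_compose[OF g f] linear_id]
      linear_compose_sub[OF g linear_id] by (simp_all add: o_def id_def)
  have "((\<lambda>y. (f (g y) - y) - f (g y - y)) ^^ (p + q)) x = 0" for x
    by (rule nilpotent_diff[OF lin f _ _ _ pq])
      (simp_all add: linear_diff[OF f] linear_diff[OF g] comm)
  then show ?thesis
    unfolding unipotent_def by (auto simp: linear_diff[OF f])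
qed

text \<open>The fixed space of \<open>s ^^ d\<close> is stable under \<open>s\<close>, hence has a
  stable complement \<open>V\<close>. On \<open>V\<close> the map \<open>s ^^ d - 1\<close> is both
  injective and nilpotent, which forces \<open>V\<close> to vanish.\<close>

lemma semisimple_unipotent_funpow:
  fixes s :: "'v::real_vector \<Rightarrow> 'v"
  assumes s: "linear s" and ss: "semisimple_on UNIV s" and uni: "unipotent (s ^^ d)"
  shows "(s ^^ d) x = x"
proof -
  let ?E = "{x. (s ^^ d) x = x}"
  have lin: "linear (s ^^ d)" using s by (rule linear_funpow)
  have "subspace ?E"
    using lin by (auto simp: subspace_def linear_0 linear_add linear_scale)
  moreover have "s ` ?E \<subseteq> ?E" by (auto simp: funpow_swap1[symmetric])
  ultimately obtain V where V: "direct_sum UNIV ?E V" "s ` V \<subseteq> V"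
    using ss unfolding semisimple_on_def by blast
  have subV: "subspace V" and int: "?E \<inter> V = {0}" using V(1) by (auto simp: direct_sum_def)
  have sV: "(s ^^ m) v \<in> V" if "v \<in> V" for m v
    using that V(2) by (induction m) auto
  have zero: "v = 0" if "v \<in> V" "((\<lambda>y. (s ^^ d) y - y) ^^ k) v = 0" for k v
    using that
  proof (induction k arbitrary: v)
    case (Suc k)
    have "(s ^^ d) v - v \<in> V" using Suc.prems(1) subV sV by (simp add: subspace_diff)
    moreover have "((\<lambda>y. (s ^^ d) y - y) ^^ k) ((s ^^ d) v - v) = 0"
      using Suc.prems(2) by (simp only: funpow_Suc_right o_apply)
    ultimately have "(s ^^ d) v - v = 0" by (rule Suc.IH)
    then show ?case using int Suc.prems(1) by auto
  qed simp
  obtain N where N: "((\<lambda>y. (s ^^ d) y - y) ^^ N) v = 0" for v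
    using uni unfolding unipotent_def by auto
  have "V \<subseteq> {0}" using zero[OF _ N] by auto
  moreover have "\<exists>e v. x = e + v \<and> e \<in> ?E \<and> v \<in> V"
    using V(1) unfolding direct_sum_def by blast
  ultimately show ?thesis by auto
qed

section \<open>Complements avoiding a countable set\<close>

text \<open>A vector \<open>x\<close> outside \<open>M + N\<close> may be replaced by any \<open>x + t a\<close>, where \<open>a\<close> is a fixed
  non-zero vector of \<open>N\<close>; each element of the countable set excludes at most one \<open>t\<close>.\<close>

lemma extend_avoiding:
  fixes M N R :: "'v::real_vector set"
  assumes M: "subspace M" and N: "subspace N" and MN: "M \<inter> N = {0}"
    and a: "a \<in> N" "a \<noteq> 0" and R: "countable R" "M \<inter> R = {}"
    and x: "\<And>m n. m \<in> M \<Longrightarrow> n \<in> N \<Longrightarrow> x \<noteq> m + n"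
  obtains t where "span (insert (x + t *\<^sub>R a) M) \<inter> N = {0}"
    "span (insert (x + t *\<^sub>R a) M) \<inter> R = {}"
proof -
  let ?S = "\<lambda>t. span (insert (x + t *\<^sub>R a) M)"
  have mem: "z \<in> ?S t \<longleftrightarrow> (\<exists>k. z - k *\<^sub>R (x + t *\<^sub>R a) \<in> M)" for z t
    using M by (simp add: span_breakdown_eq span_eq_iff[THEN iffD2])
  \<comment> \<open>Otherwise division by \<open>k\<close> would exhibit \<open>x\<close> as an
    element of \<open>M + N\<close>.\<close>
  have coeff: "k = 0" if "k *\<^sub>R x + n \<in> M" "n \<in> N" for k n
  proof (rule ccontr)
    assume k: "k \<noteq> 0"
    have "(1 / k) *\<^sub>R (k *\<^sub>R x + n) \<in> M" "(- (1 / k)) *\<^sub>R n \<in> N"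
      using that M N by (auto intro: subspace_scale simp del: scaleR_minus_left)
    from x[OF this] show False using k by (simp add: algebra_simps)
  qed
  have "countable {t. \<beta> \<in> ?S t}" if "\<beta> \<in> R" for \<beta>
  proof -
    have "t = t'" if t: "\<beta> \<in> ?S t" and t': "\<beta> \<in> ?S t'" for t t'
    proof -
      obtain k k' where k: "\<beta> - k *\<^sub>R (x + t *\<^sub>R a) \<in> M" and k': "\<beta> - k' *\<^sub>R (x + t' *\<^sub>R a) \<in> M"
        using t t' mem by blast
      \<comment> \<open>Subtraction eliminates the root; \<open>coeff\<close> then gives equal
        coefficients \<open>k = k'\<close>, and what remains is a multiple of \<open>a\<close> in
        \<open>M\<close> and \<open>N\<close>.\<close>
      have "(\<beta> - k' *\<^sub>R (x + t' *\<^sub>R a)) - (\<beta> - k *\<^sub>R (x + t *\<^sub>R a)) \<in> M"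
        using M k' k by (rule subspace_diff)
      then have *: "(k - k') *\<^sub>R x + (k * t - k' * t') *\<^sub>R a \<in> M"
        by (simp add: algebra_simps)
      have inN: "r *\<^sub>R a \<in> N" for r using N a(1) by (rule subspace_scale)
      have kk: "k = k'" using coeff[OF * inN] by simp
      have "(k * t - k' * t') *\<^sub>R a \<in> M \<inter> N" using * inN kk by auto
      then have "(k * t - k' * t') *\<^sub>R a = 0" using MN by blast
      \<comment> \<open>For \<open>k = 0\<close> the root would already lie in
        \<open>M\<close>.\<close>
      moreover have "k \<noteq> 0" using k R(2) \<open>\<beta> \<in> R\<close> by auto
      ultimately show ?thesis using a(2) kk by simp
    qed
    then have "{t. \<beta> \<in> ?S t} \<subseteq> {SOME t. \<beta> \<in> ?S t}"
      by (auto intro: someI2)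
    then show ?thesis by (meson countable_subset countable_finite finite.intros)
  qed
  then have "countable (\<Union>\<beta>\<in>R. {t. \<beta> \<in> ?S t})" using R(1) by blast
  then have "(\<Union>\<beta>\<in>R. {t. \<beta> \<in> ?S t}) \<noteq> UNIV" using uncountable_UNIV_real by metis
  then obtain t where t: "?S t \<inter> R = {}" by blast
  have "z = 0" if z: "z \<in> ?S t" "z \<in> N" for z
  proof -
    obtain k where k: "z - k *\<^sub>R (x + t *\<^sub>R a) \<in> M" using z(1) unfolding mem by blast
    have "(- k) *\<^sub>R x + (z - (k * t) *\<^sub>R a) = z - k *\<^sub>R (x + t *\<^sub>R a)"
      by (simp add: scaleR_add_right)
    then have "(- k) *\<^sub>R x + (z - (k * t) *\<^sub>R a) \<in> M" using k by (simp only:)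
    moreover have "z - (k * t) *\<^sub>R a \<in> N"
      using N z(2) a(1) by (intro subspace_diff subspace_scale)
    ultimately have "k = 0" using coeff[of "- k"] by simp
    then show ?thesis using k z(2) MN by auto
  qed
  then have "?S t \<inter> N = {0}" using N by (auto simp: span_zero subspace_0)
  then show thesis using t that by blast
qed

text \<open>The spanning set is treated one vector at a time: a vector already in
  \<open>V + N\<close> is skipped, any other one is shifted along \<open>a\<close> and adjoined to
  \<open>V\<close>. In the end \<open>V + N\<close> contains the whole spanning set.\<close>

lemma complement_avoiding_countable:
  fixes M N R B :: "'v::real_vector set"
  assumes M: "subspace M" and N: "subspace N" and MN: "M \<inter> N = {0}"
    and a: "a \<in> N" "a \<noteq> 0" and R: "countable R" "M \<inter> R = {}"
    and B: "finite B" "span B = UNIV"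
  obtains V where "M \<subseteq> V" "direct_sum UNIV V N" "V \<inter> R = {}"
proof -
  have "\<exists>V. subspace V \<and> M \<subseteq> V \<and> V \<inter> N = {0} \<and> V \<inter> R = {} \<and> B \<subseteq> {v + n |v n. v \<in> V \<and> n \<in> N}"
    using B(1)
  proof (induction B)
    case empty
    then show ?case using M MN R(2) by blast
  next
    case (insert x B)
    then obtain V where V: "subspace V" "M \<subseteq> V" "V \<inter> N = {0}" "V \<inter> R = {}"
      "B \<subseteq> {v + n |v n. v \<in> V \<and> n \<in> N}" by blast
    show ?case
    proof (cases "x \<in> {v + n |v n. v \<in> V \<and> n \<in> N}")
      case True
      then show ?thesis using V by blast
    next
      case False
      then obtain t where t: "span (insert (x + t *\<^sub>R a) V) \<inter> N = {0}"
          "span (insert (x + t *\<^sub>R a) V) \<inter> R = {}"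
        using extend_avoiding[OF V(1) N V(3) a R(1) V(4)] by blast
      let ?V = "span (insert (x + t *\<^sub>R a) V)"
      have VV: "V \<subseteq> ?V" by (meson span_superset subset_insertI subset_trans)
      have "x + t *\<^sub>R a \<in> ?V" by (simp add: span_base)
      moreover have "(- t) *\<^sub>R a \<in> N" using N a(1) by (rule subspace_scale)
      moreover have "x = (x + t *\<^sub>R a) + (- t) *\<^sub>R a" by simp
      ultimately have "x \<in> {v + n |v n. v \<in> ?V \<and> n \<in> N}" by blast
      then have "insert x B \<subseteq> {v + n |v n. v \<in> ?V \<and> n \<in> N}" using V(5) VV by blast
      then show ?thesis using t VV V(2) by (intro exI[of _ ?V]) auto
    qed
  qed
  then obtain V where V: "subspace V" "M \<subseteq> V" "V \<inter> N = {0}" "V \<inter> R = {}"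
    "B \<subseteq> {v + n |v n. v \<in> V \<and> n \<in> N}" by blast
  have "span B \<subseteq> {v + n |v n. v \<in> V \<and> n \<in> N}"
    using V(5) subspace_sums[OF V(1) N] by (rule span_minimal)
  then have "direct_sum UNIV V N"
    using V N B(2) unfolding direct_sum_def by auto
  then show thesis using V that by blast
qed

section \<open>The elliptic Weyl group\<close>

lemma full_lattice_countable:
  assumes "full_lattice F Q"
  shows "countable Q"
proof -
  obtain B where B: "finite B"
    "Q = {\<Sum>b\<in>B. of_int (z b) *\<^sub>R b |z::'a \<Rightarrow> int. True}"
    using assms unfolding full_lattice_def by blast
  \<comment> \<open>Integer functions on the whole type need not form a countable set; those
    supported on the finite set \<open>B\<close> do.\<close>
  have "Q \<subseteq> (\<lambda>z. \<Sum>b\<in>B. of_int (z b) *\<^sub>R b) ` (B \<rightarrow>\<^sub>E (UNIV :: int set))"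
  proof
    fix q assume "q \<in> Q"
    then obtain z :: "'a \<Rightarrow> int" where "q = (\<Sum>b\<in>B. of_int (z b) *\<^sub>R b)" using B by blast
    then have "q = (\<Sum>b\<in>B. of_int (restrict z B b) *\<^sub>R b)" by simp
    then show "q \<in> (\<lambda>z. \<Sum>b\<in>B. of_int (z b) *\<^sub>R b) ` (B \<rightarrow>\<^sub>E (UNIV :: int set))"
      by (intro image_eqI[of _ _ "restrict z B"]) auto
  qed
  moreover have "countable (B \<rightarrow>\<^sub>E (UNIV :: int set))"
    using B(1) by (intro countable_PiE) auto
  ultimately show ?thesis by (meson countable_image countable_subset)
qed

lemma subspace_radical:
  assumes "subspace F" "sym_bilinear_on F I"
  shows "subspace (radical F I)"
proof -
  have "I 0 y = 0" if "y \<in> F" for y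
  proof -
    have "I (0 *\<^sub>R 0) y = 0 * I 0 y"
      using assms that unfolding sym_bilinear_on_def by (metis subspace_0)
    then show ?thesis by simp
  qed
  then show ?thesis
    using assms unfolding subspace_def radical_def sym_bilinear_on_def by auto
qed

lemma reflection_involutive:
  assumes It: "sym_bilinear_on UNIV It" and "It \<alpha> \<alpha> \<noteq> 0"
  shows "reflection It \<alpha> (reflection It \<alpha> u) = u"
proof -
  have add: "It (x + y) z = It x z + It y z" and scale: "It (r *\<^sub>R x) y = r * It x y"
    and sym: "It x y = It y x" for x y z r
    using It unfolding sym_bilinear_on_def by blast+
  have diff: "It (x - k *\<^sub>R y) z = It x z - k * It y z" for x y z k
    using add[of x "(- k) *\<^sub>R y" z] scale[of "- k" y z] by simp
  have two: "It \<alpha> (coroot It \<alpha>) = 2"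
    using assms(2) sym[of \<alpha> "coroot It \<alpha>"] by (simp add: coroot_def scale)
  have neg: "k - k * 2 = - k" for k :: real by simp
  show ?thesis
    unfolding reflection_def diff two neg by simp
qed

lemma elliptic_weyl_group_acts:
  assumes It: "sym_bilinear_on UNIV It" and F: "subspace F" "R \<subseteq> F"
    and I: "\<And>x y. x \<in> F \<Longrightarrow> y \<in> F \<Longrightarrow> It x y = I x y" and R: "\<And>\<alpha>. \<alpha> \<in> R \<Longrightarrow> It \<alpha> \<alpha> \<noteq> 0"
    and g: "g \<in> elliptic_weyl_group It R"
  shows "g x - x \<in> F" and "x \<in> radical F I \<Longrightarrow> g x = x"
proof -
  \<comment> \<open>Bijectivity is carried along because product and inverse in
    \<open>BijGroup\<close> are the expected ones only on \<open>Bij UNIV\<close>.\<close>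
  let ?P = "\<lambda>g. g \<in> Bij UNIV \<and> (\<forall>x. g x - x \<in> F) \<and> (\<forall>x\<in>radical F I. g x = x)"
  have refl: "?P (reflection It \<alpha>)" if "\<alpha> \<in> R" for \<alpha>
  proof -
    have "bij (reflection It \<alpha>)"
      using reflection_involutive[OF It R[OF that]] by (intro o_bij[of "reflection It \<alpha>"]) auto
    moreover have "\<alpha> \<in> F" "coroot It \<alpha> \<in> F"
      using that F by (auto simp: coroot_def intro: subspace_scale)
    then have "reflection It \<alpha> x - x \<in> F" for x
      unfolding reflection_def using F(1) by (simp add: subspace_neg subspace_scale)
    moreover have "reflection It \<alpha> x = x" if "x \<in> radical F I" for x
      using that I \<open>coroot It \<alpha> \<in> F\<close> by (simp add: reflection_def radical_def)
    ultimately show ?thesis by (auto simp: Bij_def)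
  qed
  have "?P g" using g unfolding elliptic_weyl_group_def
  proof (induction rule: generate.induct)
    case one
    then show ?case using F(1) bij_id by (auto simp: BijGroup_def Bij_def subspace_0 id_def)
  next
    case (incl h)
    then show ?case using refl by blast
  next
    case (inv h)
    then obtain \<alpha> where h: "h = reflection It \<alpha>" "\<alpha> \<in> R" by blast
    have "h \<in> Bij UNIV" using refl h by blast
    moreover have "inv_into UNIV h = h"
      using reflection_involutive[OF It R[OF h(2)]] h(1) by (intro inv_equality) auto
    ultimately have "inv\<^bsub>BijGroup UNIV\<^esub> h = h" by (simp add: inv_BijGroup restrict_def)
    then show ?case using refl h by simp
  next
    case (eng h1 h2)
    then have "h1 \<otimes>\<^bsub>BijGroup UNIV\<^esub> h2 = compose UNIV h1 h2"
      by (simp add: BijGroup_def)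
    moreover have "compose UNIV h1 h2 = (\<lambda>x. h1 (h2 x))" by (simp add: compose_def restrict_def)
    moreover have "compose UNIV h1 h2 \<in> Bij UNIV" using eng by (simp add: compose_Bij)
    moreover have "h1 (h2 x) - x \<in> F" for x
    proof -
      have "(h1 (h2 x) - h2 x) + (h2 x - x) \<in> F"
        using eng F(1) by (intro subspace_add) auto
      then show ?thesis by simp
    qed
    ultimately show ?case using eng by simp
  qed
  then show "g x - x \<in> F" and "x \<in> radical F I \<Longrightarrow> g x = x" by auto
qed

section \<open>Semi-simple part of a map of finite order on a subspace\<close>

text \<open>The second conclusion makes every subspace containing the image of \<open>c - 1\<close>
  on \<open>F\<close> stable under \<open>s\<close>, even though \<open>c\<close> itself may have
  infinite order outside \<open>F\<close>.\<close>

lemma jordan_semisimple_part_image: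
  fixes c s u :: "'v::real_vector \<Rightarrow> 'v"
  assumes J: "mult_jordan_decomposition c s u" and F: "subspace F"
    and cF: "\<And>x. c x - x \<in> F" and d: "d > 0" and fin: "\<And>x. x \<in> F \<Longrightarrow> (c ^^ d) x = x"
  shows "(s ^^ d) x = x" and "s x - x \<in> (\<lambda>x. c x - x) ` F"
proof -
  have s: "linear s" and u: "linear u" and c: "c = s \<circ> u" and su: "s \<circ> u = u \<circ> s"
    and ss: "semisimple_on UNIV s" and uni: "unipotent u"
    using J unfolding mult_jordan_decomposition_def by auto
  have comm: "s (u x) = u (s x)" for x using su by (metis o_apply)
  have lin: "linear (s ^^ m)" "linear (u ^^ m)" "linear c" for m
    using s u c by (auto intro: linear_funpow linear_compose)
  have cmem: "c x \<in> F" if "x \<in> F" for x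
    using subspace_add[OF F that cF[of x]] by simp
  have comm_pow: "(s ^^ m) (u x) = u ((s ^^ m) x)" for m x
    using funpow_commute[of s u m x] comm by blast
  have c_pow: "(c ^^ m) x = (s ^^ m) ((u ^^ m) x)" for m x
    unfolding c by (induction m) (simp_all add: comm_pow)
  have cpF: "(c ^^ m) x - x \<in> F" for m x
  proof (induction m)
    case (Suc m)
    have "(c ((c ^^ m) x) - (c ^^ m) x) + ((c ^^ m) x - x) \<in> F"
      using F cF Suc by (rule subspace_add)
    then show ?case by simp
  qed (simp add: F subspace_0)
  \<comment> \<open>The map \<open>c ^^ d - 1\<close> sends everything into \<open>F\<close> and
    vanishes there.\<close>
  have "((\<lambda>y. (c ^^ d) y - y) ^^ 2) x = 0" for x
    using fin[OF cpF[of d x]] by (simp add: numeral_2_eq_2)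
  then have "unipotent (s ^^ d \<circ> u ^^ d)"
    unfolding unipotent_def o_def c_pow by blast
  \<comment> \<open>The commuting unipotent factors \<open>u\<close> are stripped off one by
    one.\<close>
  moreover have "unipotent (s ^^ d)" if "unipotent (s ^^ d \<circ> u ^^ m)" for m
    using that
  proof (induction m)
    case (Suc m)
    have "s ^^ d \<circ> u ^^ Suc m = (s ^^ d \<circ> u ^^ m) \<circ> u"
      by (simp add: funpow_Suc_right comp_assoc del: funpow.simps)
    moreover have "(s ^^ d \<circ> u ^^ m) \<circ> u = u \<circ> (s ^^ d \<circ> u ^^ m)"
      by (auto simp: fun_eq_iff comm_pow funpow_swap1[symmetric])
    ultimately have "unipotent (s ^^ d \<circ> u ^^ m)"
      using Suc.prems uni u lin(1,2) by (metis unipotent_left_factor linear_compose)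
    then show ?case by (rule Suc.IH)
  qed simp
  ultimately show sd: "(s ^^ d) x = x" for x
    using semisimple_unipotent_funpow[OF s ss] by blast
  have ud: "(u ^^ d) x = (c ^^ d) x" for x using c_pow sd by simp
  obtain N where N: "((\<lambda>y. u y - y) ^^ N) x = 0" for x
    using uni unfolding unipotent_def by blast
  \<comment> \<open>On \<open>F\<close> the unipotent \<open>u\<close> has finite order, as
    \<open>u ^^ d = c ^^ d\<close> is the identity there; the subspace taken is zero. The same
    argument modulo \<open>F\<close> follows.\<close>
  have uF: "u x = x" if "x \<in> F" for x
    using unipotent_mod_finite_order[OF u subspace_single_0 _ d, of N x] N ud fin[OF that] u
    by (auto simp: linear_0)
  have "u x - x \<in> F" for x
    using unipotent_mod_finite_order[OF u F _ d, of N x] N ud cpF uF F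
    by (auto simp: subspace_0)
  moreover have sF: "s x = c x" if "x \<in> F" for x using uF[OF that] c by simp
  ultimately have "s (u x - x) \<in> F" for x using cmem by metis
  moreover have "s x - x = (c x - x) - s (u x - x)" for x
    using c by (simp add: linear_diff[OF s])
  ultimately have quot: "s x - x \<in> F" for x using F cF by (metis subspace_diff)
  have "s ` F \<subseteq> F" using sF cmem by auto
  then obtain V where V: "direct_sum UNIV F V" "s ` V \<subseteq> V"
    using ss F unfolding semisimple_on_def by blast
  obtain y v where xv: "x = y + v" "y \<in> F" "v \<in> V"
    using V(1) unfolding direct_sum_def by blast
  \<comment> \<open>Since \<open>s\<close> is trivial modulo \<open>F\<close>, it fixes the stable
    complement \<open>V\<close> pointwise, so only the \<open>F\<close>-component of
    \<open>x\<close> contributes to \<open>s x - x\<close>.\<close>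
  have "s v - v \<in> V" using V xv(3) unfolding direct_sum_def by (auto intro: subspace_diff)
  then have "s v - v \<in> F \<inter> V" using quot by blast
  then have "s v = v" using V(1) unfolding direct_sum_def by simp
  then have "s x - x = c y - y" using xv sF by (simp add: linear_add[OF s])
  then show "s x - x \<in> (\<lambda>x. c x - x) ` F" using xv(2) by blast
qed

section \<open>A stable complement of the radical without roots\<close>

theorem proposition6p4:
  fixes l :: nat
    and F R G :: "'v::real_vector set"
    and I It :: "'v \<Rightarrow> 'v \<Rightarrow> real"
    and a \<delta> :: 'v
    and r :: real
    and \<alpha> :: "nat \<Rightarrow> 'v"
    and n :: "nat \<Rightarrow> nat"
    and c css cunip :: "'v \<Rightarrow> 'v"
  assumes "l \<ge> 1"
    and "elliptic_root_system l F I R"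
    and "marking F I R G a \<delta>"
    and "is_even_scale I R r"
    and "reduced_mod G R"
    and "simple_roots_mod l G R \<alpha>"
    and "null_root_coeffs l G \<delta> \<alpha> n"
    and "hyperbolic_extension l F I It a"
    and "hyperbolic_coxeter F I It R a \<delta> r (exponents l I r R a \<alpha> n) c"
    and "mult_jordan_decomposition c css cunip"
  shows "fixed_splittings F I css \<inter> regular_splittings F I R \<noteq> {}"
proof -
  let ?N = "radical F I" and ?M = "(\<lambda>x. c x - x) ` F"
  have F: "subspace F" "R \<subseteq> F" and symI: "sym_bilinear_on F I"
    and lattice: "full_lattice F (root_lattice R)"
    and nonisotropic: "\<And>\<beta>. \<beta> \<in> R \<Longrightarrow> I \<beta> \<beta> \<noteq> 0"
    using assms(2) unfolding elliptic_root_system_def by simp_all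
  have It: "sym_bilinear_on UNIV It" and It_I: "\<And>x y. x \<in> F \<Longrightarrow> y \<in> F \<Longrightarrow> It x y = I x y"
    and dimU: "dim (UNIV :: 'v set) = l + 3"
    using assms(8) unfolding hyperbolic_extension_def by blast+
  obtain d where d: "d > 0" "\<And>x. x \<in> F \<Longrightarrow> (c ^^ d) x = x"
    and cW: "c \<in> elliptic_weyl_group It R" and RM: "R \<inter> ?M = {}"
    using assms(9) unfolding hyperbolic_coxeter_def has_order_on_def by blast
  have cF: "c x - x \<in> F" and cN: "x \<in> ?N \<Longrightarrow> c x = x" for x
    using elliptic_weyl_group_acts[where I = I, OF It F It_I _ cW] nonisotropic It_I F(2)
    by (metis subsetD)+
  have css: "linear css" and c: "linear c"
    using assms(10) unfolding mult_jordan_decomposition_def by (auto intro: linear_compose)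
  have N: "subspace ?N" using F(1) symI by (rule subspace_radical)
  have M: "subspace ?M"
    using linear_subspace_image[OF linear_compose_sub[OF c linear_id] F(1)] by simp
  have "y = 0" if y: "y \<in> ?M" "y \<in> ?N" for y
  proof -
    obtain x where x: "x \<in> F" "y = c x - x" using y(1) by blast
    \<comment> \<open>As a radical vector, \<open>c x - x\<close> is fixed by \<open>c\<close>, so
      finite order on \<open>x\<close> leaves \<open>d\<close> times it equal to zero.\<close>
    have "(c ^^ d) x - x - real d *\<^sub>R (c x - x) \<in> {0}"
      using cN[OF y(2)] x(2) c by (intro funpow_mod_fixed_increment) (auto simp: linear_0)
    then show ?thesis using d x by simp
  qed
  then have MN: "?M \<inter> ?N = {0}" using M N by (auto simp: subspace_0)
  have a: "a \<in> ?N" "a \<noteq> 0"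
  proof -
    have mark: "G \<subseteq> ?N" "G \<inter> root_lattice R = {of_int i *\<^sub>R a |i::int. True}"
      "\<And>(i::int) (j::int). of_int i *\<^sub>R a + of_int j *\<^sub>R \<delta> = 0 \<Longrightarrow> i = 0 \<and> j = 0"
      using assms(3) unfolding marking_def by blast+
    have "of_int 1 *\<^sub>R a \<in> G" using mark(2) by blast
    then show "a \<in> ?N" using mark(1) by auto
    show "a \<noteq> 0" using mark(3)[of 1 0] by auto
  qed
  have "R \<subseteq> root_lattice R" by (auto intro: group_closure.base)
  then have R: "countable R" using full_lattice_countable[OF lattice] by (rule countable_subset)
  obtain B :: "'v set" where B: "finite B" "span B = UNIV"
  proof -
    obtain B :: "'v set" where "independent B" "span B = UNIV" "card B = dim (UNIV :: 'v set)"
      by (metis basis_exists[of "UNIV :: 'v set"] top.extremum_uniqueI)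
    \<comment> \<open>An infinite set has \<open>card\<close> zero, whereas the dimension
      \<open>l + 3\<close> is positive.\<close>
    then show thesis using that dimU by (metis card.infinite add_is_0 zero_neq_numeral)
  qed
  have "?M \<inter> R = {}" using RM by (simp only: Int_commute)
  then obtain V where V: "?M \<subseteq> V" "direct_sum UNIV V ?N" "V \<inter> R = {}"
    using complement_avoiding_countable[OF M N MN a R _ B] by metis
  note image = jordan_semisimple_part_image[OF assms(10) F(1) cF d]
  have sV: "css x \<in> V" if "x \<in> V" for x
  proof -
    have "subspace V" using V(2) unfolding direct_sum_def by simp
    moreover have "css x - x \<in> V" using V(1) image(2) by (rule subsetD)
    ultimately have "x + (css x - x) \<in> V" using that by (simp only: subspace_add)
    then show ?thesis by simp
  qed
  then have pow: "(css ^^ m) x \<in> V" if "x \<in> V" for m x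
    using that by (induction m) auto
  have "V \<subseteq> css ` V"
  proof
    fix x assume "x \<in> V"
    \<comment> \<open>Since \<open>css ^^ d\<close> is the identity, the power \<open>d - 1\<close>
      supplies a preimage inside \<open>V\<close>.\<close>
    have "css ((css ^^ (d - 1)) x) = x"
      using image(1) d(1) by (metis Suc_pred' comp_apply funpow.simps(2))
    then show "x \<in> css ` V" using pow[OF \<open>x \<in> V\<close>] by (metis imageI)
  qed
  then have "css ` V = V" using sV by auto
  then show ?thesis
    using V unfolding fixed_splittings_def regular_splittings_def splittings_def by blast
qed

end
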